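(* For any integer $d \ge 2$, there is an infinite family of $n$-node directed graphs $G$ and pair sets $P$ for which every reachability preserver of $G, P$ has $\Omega\left(n^{2/(d+1)} |P|^{(d-1)/d} \right)$ edges.
   Context: For a directed graph $G=(V,E)$ and a set of node pairs $P \subseteq V \times V$, a reachability preserver of $G,P$ is a subgraph $H=(V,E')$ with $E' \subseteq E$ such that for all $(s,t) \in P$, $H$ contains a directed path from $s$ to $t$ if and only if $G$ does. *)

theory Defs
  imports Complex_Main "Graph_Theory.Graph_Theory"
begin

text \<open>
  A directed graph \<open>G = (V, E)\<close> with \<open>E \<subseteq> V \<times> V\<close> is a \<^typ>\<open>'a pair_pre_digraph\<close> satisfying
  \<^locale>\<open>pair_fin_digraph\<close>. \<^const>\<open>spanning\<close> expresses \<open>H = (V, E')\<close> with \<open>E' \<subseteq> E\<close>. The relation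
  \<open>\<rightarrow>\<^sup>*\<close> includes the empty path, so every node reaches itself.
\<close>

definition reachability_preserver ::
    "'a pair_pre_digraph \<Rightarrow> ('a \<times> 'a) set \<Rightarrow> 'a pair_pre_digraph \<Rightarrow> bool" where
  "reachability_preserver G P H \<longleftrightarrow>
     spanning (with_proj H) (with_proj G) \<and>
     (\<forall>(s, t)\<in>P. s \<rightarrow>\<^sup>*\<^bsub>with_proj H\<^esub> t \<longleftrightarrow> s \<rightarrow>\<^sup>*\<^bsub>with_proj G\<^esub> t)"

end

theory Submission
  imports Defs
begin

text \<open>
  The nodes lie in \<open>l + 1\<close> layers, each a box in \<open>\<int>\<^sup>d\<close>. An edge to the next layer adds a vector
  \<open>(x, \<parallel>x\<parallel>\<^sup>2)\<close> with \<open>x \<in> {0,\<dots>,a - 1}\<^bsup>d-1\<^esup>\<close>, and a demand pair joins a point of the first layer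
  to the point reached by repeating one vector \<open>l\<close> times. These vectors lie on a paraboloid, so by
  strict convexity that walk is the only one between its ends; distinct demand pairs have disjoint
  walks, so all edges are needed. Up to constants this gives \<open>n = (l a)\<^bsup>d+1\<^esup>\<close>, \<open>p = (l a\<^sup>2)\<^sup>d\<close> and
  \<open>l p = n\<^bsup>2/(d+1)\<^esup> p\<^bsup>(d-1)/d\<^esup>\<close> edges. A box with sides \<open>a, \<dots>, a, a\<^sup>2\<close> in place of a cube makes the
  paraboloid a large enough convex set. Outside the range of these parameters, a path (few pairs)
  or a bipartite graph (many pairs) suffices.
\<close>

section \<open>Forced edge sets and their transfer to preserver bounds\<close>

text \<open>Stated for a relation on any type, so that the grid can live on tuples.
  \<open>P \<subseteq> F\<^sup>*\<close> makes every demand reachable in the host graph;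
  preservation by a subgraph with edges \<open>E\<close> then amounts to
  \<open>P \<subseteq> E\<^sup>*\<close>.\<close>

definition forced :: "'a rel \<Rightarrow> 'a rel \<Rightarrow> bool" where
  "forced F P \<longleftrightarrow> P \<subseteq> F\<^sup>* \<and> (\<forall>E\<subseteq>F. P \<subseteq> E\<^sup>* \<longrightarrow> E = F)"

definition preserver_bound :: "nat \<Rightarrow> nat \<Rightarrow> nat \<Rightarrow> bool" where
  "preserver_bound n p k \<longleftrightarrow>
     (\<exists>(G :: nat pair_pre_digraph) P.
        pair_fin_digraph G \<and> card (pverts G) = n \<and>
        P \<subseteq> pverts G \<times> pverts G \<and> card P = p \<and>
        (\<forall>H. reachability_preserver G P H \<longrightarrow> k \<le> card (parcs H)))"

lemma reachable_with_projI:
  assumes "(s, t) \<in> (parcs G)\<^sup>*" "s \<in> pverts G" "parcs G \<subseteq> pverts G \<times> pverts G"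
  shows "s \<rightarrow>\<^sup>*\<^bsub>with_proj G\<^esub> t"
  using assms(1)
proof (induction rule: rtrancl_induct)
  case base
  then show ?case using assms(2) by (simp add: reachable_def)
next
  case (step u v)
  then show ?case
    using assms(3) by (auto simp: reachable_def intro: rtrancl_on_into_rtrancl_on)
qed

lemma reachable_with_projD:
  "s \<rightarrow>\<^sup>*\<^bsub>with_proj G\<^esub> t \<Longrightarrow> (s, t) \<in> (parcs G)\<^sup>*"
  by (auto simp: reachable_def dest: rtrancl_on_rtranclI)

lemma rtrancl_map_prod:
  "(s, t) \<in> R\<^sup>* \<Longrightarrow> (f s, f t) \<in> (map_prod f f ` R)\<^sup>*"
proof (induction rule: rtrancl_induct)
  case (step u v)
  then have "(f u, f v) \<in> map_prod f f ` R" by force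
  with step.IH show ?case by (rule rtrancl_into_rtrancl)
qed simp

text \<open>A walk in the image is pulled back edge by edge. Each node reached stays in
  \<open>V\<close>, so injectivity identifies it with the tail of the next edge.\<close>

lemma rtrancl_map_prod_inj_onD:
  assumes "(f s, y) \<in> (map_prod f f ` R)\<^sup>*" "inj_on f V" "R \<subseteq> V \<times> V" "s \<in> V"
  shows "\<exists>t\<in>V. y = f t \<and> (s, t) \<in> R\<^sup>*"
  using assms(1)
proof (induction rule: rtrancl_induct)
  case base
  then show ?case using assms(4) by auto
next
  case (step u v)
  then obtain t where t: "t \<in> V" "u = f t" "(s, t) \<in> R\<^sup>*" by blast
  from step.hyps(2) obtain b c where bc: "(b, c) \<in> R" "u = f b" "v = f c" by auto
  with t assms(2,3) have "b = t" by (auto dest: inj_onD)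
  with t bc assms(3) show ?case by (auto intro: rtrancl_into_rtrancl)
qed

text \<open>Isolated nodes and additional pairs pad a forced instance to any larger size.\<close>

lemma forced_imp_preserver_bound:
  fixes V :: "'a set"
  assumes fin: "finite V" and FV: "F \<subseteq> V \<times> V" and PV: "P \<subseteq> V \<times> V"
    and cV: "card V \<le> n" and cP: "card P \<le> p" and pn: "p \<le> n\<^sup>2" and forced: "forced F P"
  shows "preserver_bound n p (card F)"
proof -
  obtain f :: "'a \<Rightarrow> nat" where f: "inj_on f V" "f ` V \<subseteq> {..<n}"
    using card_le_inj[of V "{..<n}"] fin cV by auto
  define g where "g = map_prod f f"
  have injg: "inj_on g (V \<times> V)"
    using f(1) unfolding g_def by (rule map_prod_inj_on[OF _ f(1)])
  have finP: "finite P" using PV fin by (meson finite_SigmaI finite_subset)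
  have finF: "finite F" using FV fin by (meson finite_SigmaI finite_subset)
  have gP: "g ` P \<subseteq> {..<n} \<times> {..<n}" and gF: "g ` F \<subseteq> {..<n} \<times> {..<n}"
    using PV FV f(2) unfolding g_def by auto
  have "card (g ` P) \<le> p" using card_image_le[OF finP, of g] cP by simp
  moreover have "p \<le> card ({..<n} \<times> {..<n})" using pn by (simp add: power2_eq_square)
  ultimately obtain P' where P': "g ` P \<subseteq> P'" "P' \<subseteq> {..<n} \<times> {..<n}" "card P' = p"
    using gP by (metis exists_subset_between finite_SigmaI finite_lessThan)
  define G where "G = \<lparr>pverts = {..<n}, parcs = g ` F\<rparr>"
  have "pair_fin_digraph G"
    using gF finF by unfold_locales (auto simp: G_def g_def)
  moreover have "card F \<le> card (parcs H)" if H: "reachability_preserver G P' H" for H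
  proof -
    have sub: "parcs H \<subseteq> g ` F"
      using H by (auto simp: reachability_preserver_def spanning_def subgraph_def G_def)
    \<comment> \<open>The edges of \<open>H\<close> pulled back along the relabelling; since
      \<open>H\<close> uses only edges of \<open>G\<close>, their image is all of
      \<open>parcs H\<close>.\<close>
    define E where "E = {e \<in> F. g e \<in> parcs H}"
    have gE: "g ` E = parcs H" and EF: "E \<subseteq> F" using sub by (auto simp: E_def)
    have "P \<subseteq> E\<^sup>*"
    proof
      fix e assume e: "e \<in> P"
      obtain s t where st: "e = (s, t)" by (cases e)
      have V: "s \<in> V" "t \<in> V" using e st PV by auto
      have "(s, t) \<in> F\<^sup>*" using e st forced by (auto simp: forced_def)
      then have "(f s, f t) \<in> (g ` F)\<^sup>*" unfolding g_def by (rule rtrancl_map_prod)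
      then have "f s \<rightarrow>\<^sup>*\<^bsub>with_proj G\<^esub> f t"
        using f(2) V gF by (intro reachable_with_projI) (auto simp: G_def)
      moreover have "(f s, f t) \<in> P'" using e st P'(1) by (auto simp: g_def)
      ultimately have "f s \<rightarrow>\<^sup>*\<^bsub>with_proj H\<^esub> f t"
        using H by (auto simp: reachability_preserver_def)
      then have "(f s, f t) \<in> (map_prod f f ` E)\<^sup>*"
        using gE by (auto simp: g_def dest: reachable_with_projD)
      moreover have "E \<subseteq> V \<times> V" using EF FV by blast
      ultimately obtain t' where "t' \<in> V" "f t = f t'" "(s, t') \<in> E\<^sup>*"
        using rtrancl_map_prod_inj_onD[OF _ f(1) _ V(1)] by metis
      then show "e \<in> E\<^sup>*" using f(1) V st by (auto dest: inj_onD)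
    qed
    then have "E = F" using forced EF by (auto simp: forced_def)
    then show ?thesis
      using gE card_image[OF inj_on_subset[OF injg FV]] by simp
  qed
  ultimately show ?thesis
    unfolding preserver_bound_def using P' by (intro exI[of _ G] exI[of _ P']) (auto simp: G_def)
qed

section \<open>Few or many pairs: the path and the bipartite graph\<close>

text \<open>The single pair of end nodes forces the whole path, since a walk from \<open>0\<close>
  can only advance by one node at a time.\<close>

lemma preserver_bound_path:
  assumes "1 \<le> n" "1 \<le> p" "p \<le> n\<^sup>2"
  shows "preserver_bound n p (n - 1)"
proof -
  define F where "F = (\<lambda>i. (i, Suc i)) ` {..<n - 1}"
  have walk: "(0, k) \<in> F\<^sup>*" if "k \<le> n - 1" for k
    using that
  proof (induction k)
    case (Suc k)
    then have "(k, Suc k) \<in> F" by (auto simp: F_def)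
    with Suc show ?case by (auto intro: rtrancl_into_rtrancl)
  qed simp
  have edges: "\<forall>i<v. (i, Suc i) \<in> E" if "E \<subseteq> F" "(0, v) \<in> E\<^sup>*" for E v
    using that(2)
  proof (induction rule: rtrancl_induct)
    case (step u v)
    then have "v = Suc u" using that(1) by (auto simp: F_def)
    with step show ?case by (auto simp: less_Suc_eq)
  qed simp
  have "E = F" if "E \<subseteq> F" "{(0, n - 1)} \<subseteq> E\<^sup>*" for E
    using edges[OF that(1), of "n - 1"] that by (auto simp: F_def)
  then have "forced F {(0, n - 1)}"
    using walk[of "n - 1"] by (auto simp: forced_def)
  then have "preserver_bound n p (card F)"
    using assms by (intro forced_imp_preserver_bound[of "{..<n}"]) (auto simp: F_def)
  moreover have "card F = n - 1" unfolding F_def by (subst card_image) (auto simp: inj_on_def)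
  ultimately show ?thesis by simp
qed

text \<open>All edges run from \<open>{..<h}\<close> to \<open>{h..<2*h}\<close>, so no two can be
  chained and an edge is the only walk between its ends. The edge set therefore serves as its own
  set of demands.\<close>

lemma preserver_bound_bipartite:
  assumes "k \<le> h\<^sup>2" "2 * h \<le> n" "k \<le> p" "p \<le> n\<^sup>2"
  shows "preserver_bound n p k"
proof -
  have "k \<le> card ({..<h} \<times> {h..<2*h})" using assms(1) by (simp add: power2_eq_square)
  then obtain F where F: "F \<subseteq> {..<h} \<times> {h..<2*h}" "card F = k"
    by (metis obtain_subset_with_card_n)
  have edge: "(s, t) \<in> E" if "E \<subseteq> F" "(s, t) \<in> F" "(s, t) \<in> E\<^sup>*" for E s t
    using that(3)
  proof (cases rule: converse_rtranclE)
    case base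
    then show ?thesis using F(1) that(2) by auto
  next
    case (step b)
    have "b = t" using step(2)
    proof (cases rule: converse_rtranclE)
      case (step c)
      then have "(b, c) \<in> F" "(s, b) \<in> F" using \<open>(s, b) \<in> E\<close> that(1) by auto
      then have "b < h" "h \<le> b" using F(1) by auto
      then show ?thesis by simp
    qed
    with step show ?thesis by simp
  qed
  have "E = F" if "E \<subseteq> F" "F \<subseteq> E\<^sup>*" for E
  proof (intro subset_antisym subrelI)
    show "(s, t) \<in> E" if "(s, t) \<in> F" for s t
      using edge[OF \<open>E \<subseteq> F\<close> that] that \<open>F \<subseteq> E\<^sup>*\<close> by (simp add: subset_iff)
  qed (use that in auto)
  then have "forced F F" by (auto simp: forced_def)
  then have "preserver_bound n p (card F)"
  proof (intro forced_imp_preserver_bound[of "{..<2*h}"])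
    show "F \<subseteq> {..<2*h} \<times> {..<2*h}" "F \<subseteq> {..<2*h} \<times> {..<2*h}"
      using F(1) by fastforce+
  qed (use F assms in auto)
  then show ?thesis using F by simp
qed

section \<open>The layered grid with directions on a paraboloid\<close>

context
  fixes m a l :: nat
begin

text \<open>Here \<open>m\<close> is \<open>d - 1\<close>. Vectors are extensional functions, so
  agreement on \<open>{..<m}\<close> is equality and \<open>card_PiE\<close> counts them.\<close>

definition "dirs = (\<Pi>\<^sub>E j\<in>{..<m}. {..<a})"

definition "starts = (\<Pi>\<^sub>E j\<in>{..<m}. {..<l * a})"

definition sqnorm :: "(nat \<Rightarrow> nat) \<Rightarrow> nat" where
  "sqnorm x = (\<Sum>j<m. (x j)\<^sup>2)"

definition grid_point :: "nat \<Rightarrow> (nat \<Rightarrow> nat) \<Rightarrow> (nat \<Rightarrow> nat) \<Rightarrow> nat \<Rightarrow> nat \<times> (nat \<Rightarrow> nat) \<times> nat" where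
  "grid_point i x y z = (i, \<lambda>j\<in>{..<m}. y j + i * x j, z + i * sqnorm x)"

text \<open>Effect of an edge in terms of its tail and direction alone, as needed for walks that mix
  directions.\<close>

definition grid_step :: "(nat \<Rightarrow> nat) \<Rightarrow> nat \<times> (nat \<Rightarrow> nat) \<times> nat \<Rightarrow> nat \<times> (nat \<Rightarrow> nat) \<times> nat" where
  "grid_step x = (\<lambda>(i, u, z). (Suc i, \<lambda>j\<in>{..<m}. u j + x j, z + sqnorm x))"

definition "grid_edge = (\<lambda>(i, x, y, z). (grid_point i x y z, grid_point (Suc i) x y z))"

definition "grid_edges = grid_edge ` ({..<l} \<times> dirs \<times> starts \<times> {..<l * a\<^sup>2})"

definition "grid_pairs =
  (\<lambda>(x, y, z). (grid_point 0 x y z, grid_point l x y z)) ` (dirs \<times> starts \<times> {..<l * a\<^sup>2})"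

text \<open>Over \<open>l\<close> steps a horizontal coordinate grows by at most
  \<open>l * a\<close> and the height by at most \<open>m * l * a\<^sup>2\<close>. The box of
  starting points has sides of the same order, so every layer fits in a box larger by a constant
  factor only.\<close>

definition "grid_nodes = {..l} \<times> (\<Pi>\<^sub>E j\<in>{..<m}. {..<2 * l * a}) \<times> {..<(m + 1) * l * a\<^sup>2}"

text \<open>
  The height above a multiple of the tangent plane of the paraboloid at \<open>x\<close>: a step in
  direction \<open>w\<close> raises it by \<open>\<parallel>w - x\<parallel>\<^sup>2\<close>.
\<close>

definition potential :: "(nat \<Rightarrow> nat) \<Rightarrow> nat \<times> (nat \<Rightarrow> nat) \<times> nat \<Rightarrow> int" where
  "potential x = (\<lambda>(i, u, z).
     int z - 2 * (\<Sum>j<m. int (x j) * int (u j)) + int i * (\<Sum>j<m. (int (x j))\<^sup>2))"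

lemma grid_step_grid_point: "grid_step x (grid_point i x y z) = grid_point (Suc i) x y z"
  by (auto simp: grid_step_def grid_point_def fun_eq_iff)

lemma potential_grid_step:
  "potential x (grid_step w v) - potential x v = (\<Sum>j<m. (int (w j) - int (x j))\<^sup>2)"
proof -
  obtain i u z where v: "v = (i, u, z)" by (metis prod.exhaust)
  show ?thesis
    by (simp add: v potential_def grid_step_def sqnorm_def power2_eq_square algebra_simps
        sum.distrib sum_subtractf sum_distrib_left)
qed

text \<open>Strict convexity: the increment is a sum of squares, which vanishes only for
  \<open>w = x\<close>.\<close>

lemma potential_grid_step_eqD:
  assumes "potential x (grid_step w v) = potential x v" "x \<in> dirs" "w \<in> dirs"
  shows "w = x"
proof (rule PiE_ext)
  show "w \<in> (\<Pi>\<^sub>E j\<in>{..<m}. {..<a})" "x \<in> (\<Pi>\<^sub>E j\<in>{..<m}. {..<a})"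
    using assms(2,3) by (simp_all add: dirs_def)
  have "(\<Sum>j<m. (int (w j) - int (x j))\<^sup>2) = 0"
    using potential_grid_step[of x w v] assms(1) by simp
  then show "w j = x j" if "j \<in> {..<m}" for j
    using that by (auto simp: sum_nonneg_eq_0_iff)
qed

lemma grid_edgesD:
  "(v, v') \<in> grid_edges \<Longrightarrow> \<exists>w\<in>dirs. v' = grid_step w v"
  by (auto simp: grid_edges_def grid_edge_def simp flip: grid_step_grid_point)

lemma potential_mono:
  assumes "(s, v) \<in> grid_edges\<^sup>*"
  shows "potential x s \<le> potential x v"
  using assms
proof (induction rule: rtrancl_induct)
  case (step u v)
  obtain w where "v = grid_step w u" using grid_edgesD[OF step.hyps(2)] by blast
  moreover have "(\<Sum>j<m. (int (w j) - int (x j))\<^sup>2) \<ge> 0" by (simp add: sum_nonneg)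
  ultimately show ?case using step.IH potential_grid_step[of x w u] by simp
qed simp

text \<open>The potential never drops along an edge. If it agrees at both ends of a walk, no step
  raises it, so every step has direction \<open>x\<close>. The end \<open>v\<close> is left general
  for the induction, and membership in \<open>E\<close> is recorded because it is what forcing
  requires.\<close>

lemma grid_walk_unique:
  assumes "E \<subseteq> grid_edges" "x \<in> dirs" "(grid_point 0 x y z, v) \<in> E\<^sup>*"
    and "potential x v = potential x (grid_point 0 x y z)"
  shows "\<exists>k. v = grid_point k x y z \<and> (\<forall>i<k. grid_edge (i, x, y, z) \<in> E)"
  using assms(3,4)
proof (induction rule: rtrancl_induct)
  case (step u v)
  have uv: "(u, v) \<in> grid_edges" using step.hyps(2) assms(1) by blast
  have "E\<^sup>* \<subseteq> grid_edges\<^sup>*" using assms(1) by (rule rtrancl_mono)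
  then have "potential x (grid_point 0 x y z) \<le> potential x u"
    using step.hyps(1) potential_mono by blast
  moreover have "potential x u \<le> potential x v" using uv potential_mono by blast
  ultimately have pu: "potential x u = potential x (grid_point 0 x y z)"
    "potential x v = potential x u" using step.prems by simp_all
  obtain w where w: "w \<in> dirs" "v = grid_step w u" using grid_edgesD[OF uv] by blast
  then have "w = x" using potential_grid_step_eqD[OF _ assms(2) w(1)] pu(2) by blast
  from step.IH[OF pu(1)] obtain k where
    k: "u = grid_point k x y z" "\<forall>i<k. grid_edge (i, x, y, z) \<in> E" by blast
  then have "v = grid_point (Suc k) x y z" using w \<open>w = x\<close> by (simp add: grid_step_grid_point)
  moreover from this have "grid_edge (k, x, y, z) \<in> E"
    using k step.hyps(2) by (simp add: grid_edge_def)
  ultimately show ?case using k(2) by (metis less_Suc_eq)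
qed (auto intro: exI[of _ 0])

lemma potential_grid_point: "potential x (grid_point i x y z) = potential x (grid_point 0 x y z)"
proof (induction i)
  case (Suc i)
  then show ?case
    using potential_grid_step[of x x "grid_point i x y z"] by (simp add: grid_step_grid_point)
qed simp

lemma grid_walk:
  assumes "k \<le> l" "x \<in> dirs" "y \<in> starts" "z < l * a\<^sup>2"
  shows "(grid_point 0 x y z, grid_point k x y z) \<in> grid_edges\<^sup>*"
  using assms(1)
proof (induction k)
  case (Suc k)
  then have "grid_edge (k, x, y, z) \<in> grid_edges"
    using assms by (auto simp: grid_edges_def)
  then show ?case using Suc by (auto simp: grid_edge_def intro: rtrancl_into_rtrancl)
qed simp

lemma forced_grid: "forced grid_edges grid_pairs"
  unfolding forced_def
proof (intro conjI allI impI)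
  show "grid_pairs \<subseteq> grid_edges\<^sup>*"
    using grid_walk by (auto simp: grid_pairs_def)
next
  fix E assume E: "E \<subseteq> grid_edges" "grid_pairs \<subseteq> E\<^sup>*"
  have "grid_edge (i, x, y, z) \<in> E"
    if "i < l" "x \<in> dirs" "y \<in> starts" "z < l * a\<^sup>2" for i x y z
  proof -
    have "(grid_point 0 x y z, grid_point l x y z) \<in> E\<^sup>*"
      using that by (intro subsetD[OF E(2)]) (force simp: grid_pairs_def)
    from grid_walk_unique[OF E(1) that(2) this potential_grid_point]
    obtain k where "grid_point l x y z = grid_point k x y z" "\<forall>i<k. grid_edge (i, x, y, z) \<in> E"
      by blast
    \<comment> \<open>Comparing layers gives \<open>k = l\<close>, so the index \<open>i < l\<close>
      is covered.\<close>
    then show ?thesis using that(1) by (simp add: grid_point_def)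
  qed
  then show "E = grid_edges" using E(1) by (auto simp: grid_edges_def)
qed

text \<open>The tail gives the layer, the difference of the two ends gives \<open>x\<close>, and
  then \<open>y\<close> and \<open>z\<close> follow. Thus distinct demand walks share no
  edge.\<close>

lemma inj_on_grid_edge: "inj_on grid_edge (UNIV \<times> dirs \<times> starts \<times> UNIV)"
proof (rule inj_onI)
  fix e e' assume e: "e \<in> UNIV \<times> dirs \<times> starts \<times> UNIV" "e' \<in> UNIV \<times> dirs \<times> starts \<times> UNIV"
    and ee': "grid_edge e = grid_edge e'"
  obtain i x y z i' x' y' z' where parts: "e = (i, x, y, z)" "e' = (i', x', y', z')"
    by (metis prod_cases4)
  have mem: "x \<in> dirs" "y \<in> starts" "x' \<in> dirs" "y' \<in> starts"
    and eq: "grid_edge (i, x, y, z) = grid_edge (i', x', y', z')"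
    using e ee' parts by simp_all
  have i: "i' = i" using eq by (simp add: grid_edge_def grid_point_def)
  have pt: "(\<lambda>j\<in>{..<m}. y j + k * x j) = (\<lambda>j\<in>{..<m}. y' j + k * x' j)" if "k \<in> {i, Suc i}" for k
    using eq that by (auto simp: grid_edge_def grid_point_def i)
  have xy: "x j = x' j \<and> y j = y' j" if "j < m" for j
  proof -
    have "y j + i * x j = y' j + i * x' j" "y j + Suc i * x j = y' j + Suc i * x' j"
      using fun_cong[OF pt[of i], of j] fun_cong[OF pt[of "Suc i"], of j] that by simp_all
    moreover from this have "x j = x' j" by simp
    ultimately show ?thesis by simp
  qed
  have "x = x'"
    using mem(1,3) xy unfolding dirs_def by (intro PiE_ext) auto
  moreover have "y = y'"
    using mem(2,4) xy unfolding starts_def by (intro PiE_ext) auto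
  moreover have "z = z'"
    using eq calculation by (simp add: grid_edge_def grid_point_def i)
  ultimately show "e = e'" using i parts by simp
qed

lemma card_grid_edges: "card grid_edges = l * (l * a\<^sup>2) ^ (m + 1)"
proof -
  have "card grid_edges = card ({..<l} \<times> dirs \<times> starts \<times> {..<l * a\<^sup>2})"
    unfolding grid_edges_def by (intro card_image inj_on_subset[OF inj_on_grid_edge]) auto
  also have "\<dots> = l * (a ^ m * ((l * a) ^ m * (l * a\<^sup>2)))"
    by (simp add: card_cartesian_product dirs_def starts_def card_PiE)
  also have "\<dots> = l * (l * a\<^sup>2) ^ (m + 1)"
    by (simp add: power_mult_distrib power2_eq_square algebra_simps)
  finally show ?thesis .
qed

lemma card_grid_pairs: "card grid_pairs \<le> (l * a\<^sup>2) ^ (m + 1)"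
proof -
  have "card grid_pairs \<le> card (dirs \<times> starts \<times> {..<l * a\<^sup>2})"
    unfolding grid_pairs_def
    by (intro card_image_le finite_SigmaI) (auto simp: dirs_def starts_def intro!: finite_PiE)
  also have "\<dots> = a ^ m * ((l * a) ^ m * (l * a\<^sup>2))"
    by (simp add: card_cartesian_product dirs_def starts_def card_PiE)
  also have "\<dots> = (l * a\<^sup>2) ^ (m + 1)"
    by (simp add: power_mult_distrib power2_eq_square algebra_simps)
  finally show ?thesis .
qed

lemma card_grid_nodes:
  assumes "1 \<le> l"
  shows "card grid_nodes \<le> 2 ^ (m + 1) * (m + 1) * (l * a) ^ (m + 2)"
proof -
  have "card grid_nodes = (l + 1) * ((2 * l * a) ^ m * ((m + 1) * l * a\<^sup>2))"
    by (simp add: card_cartesian_product grid_nodes_def card_PiE)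
  \<comment> \<open>The extra layer in \<open>l + 1\<close> is absorbed using
    \<open>1 \<le> l\<close>.\<close>
  also have "\<dots> \<le> (2 * l) * ((2 * l * a) ^ m * ((m + 1) * l * a\<^sup>2))"
    using assms by (intro mult_right_mono) auto
  also have "\<dots> = 2 ^ (m + 1) * (m + 1) * (l * a) ^ (m + 2)"
    by (simp add: power_mult_distrib power2_eq_square algebra_simps)
  finally show ?thesis .
qed

lemma grid_point_in_grid_nodes:
  assumes "i \<le> l" "x \<in> dirs" "y \<in> starts" "z < l * a\<^sup>2"
  shows "grid_point i x y z \<in> grid_nodes"
proof -
  have "y j + i * x j < 2 * l * a" if "j < m" for j
  proof -
    have "y j < l * a" "x j < a" using assms that by (auto simp: dirs_def starts_def)
    moreover from this have "i * x j \<le> l * a" using assms(1) by (intro mult_mono) auto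
    ultimately show ?thesis by simp
  qed
  moreover have "z + i * sqnorm x < (m + 1) * l * a\<^sup>2"
  proof -
    have "sqnorm x \<le> (\<Sum>j<m. a\<^sup>2)"
      unfolding sqnorm_def
    proof (intro sum_mono power_mono)
      show "x j \<le> a" if "j \<in> {..<m}" for j
        using PiE_mem[OF assms(2)[unfolded dirs_def] that] by simp
    qed simp
    then have "sqnorm x \<le> m * a\<^sup>2" by simp
    then have "i * sqnorm x \<le> l * (m * a\<^sup>2)" using assms(1) by (intro mult_mono) auto
    then show ?thesis using assms(4) by (simp add: algebra_simps)
  qed
  ultimately show ?thesis using assms(1) by (auto simp: grid_point_def grid_nodes_def)
qed

lemma preserver_bound_grid:
  assumes "1 \<le> l" "2 ^ (m + 1) * (m + 1) * (l * a) ^ (m + 2) \<le> n"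
    and "(l * a\<^sup>2) ^ (m + 1) \<le> p" "p \<le> n\<^sup>2"
  shows "preserver_bound n p (l * (l * a\<^sup>2) ^ (m + 1))"
proof -
  have "preserver_bound n p (card grid_edges)"
  proof (rule forced_imp_preserver_bound[OF _ _ _ _ _ assms(4) forced_grid])
    show "finite grid_nodes" by (auto simp: grid_nodes_def intro!: finite_PiE)
    show "grid_edges \<subseteq> grid_nodes \<times> grid_nodes"
      by (auto simp: grid_edges_def grid_edge_def intro!: grid_point_in_grid_nodes)
    show "grid_pairs \<subseteq> grid_nodes \<times> grid_nodes"
      by (auto simp: grid_pairs_def intro!: grid_point_in_grid_nodes)
    show "card grid_nodes \<le> n" using card_grid_nodes[OF assms(1)] assms(2) by simp
    show "card grid_pairs \<le> p" using card_grid_pairs assms(3) by simp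
  qed
  then show ?thesis by (simp add: card_grid_edges)
qed

end

section \<open>Integer roots and the choice of parameters\<close>

text \<open>\<open>M\<close> is the integer part of the \<open>k\<close>-th root of
  \<open>n / C\<close>. The lower estimate makes a construction fit, the upper one shows that little
  is lost.\<close>

lemma ex_nat_root:
  fixes C k n :: nat
  assumes "1 \<le> C" "1 \<le> k"
  shows "\<exists>M. C * M ^ k \<le> n \<and> n < C * (M + 1) ^ k"
proof -
  have bnd: "M \<le> n" if "C * M ^ k \<le> n" for M
  proof -
    have "M \<le> M ^ k" using assms(2) by (cases "M = 0") (auto intro: self_le_power)
    also have "\<dots> \<le> C * M ^ k" using assms(1) by simp
    finally show ?thesis using that by simp
  qed
  define M where "M = (GREATEST M. C * M ^ k \<le> n)"
  have 0: "C * 0 ^ k \<le> n" using assms(2) by (simp add: zero_power)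
  have "C * M ^ k \<le> n" unfolding M_def 
    by (rule GreatestI_nat[where P = "\<lambda>M. C * M ^ k \<le> n" and k = 0 and b = n, OF 0 bnd])
  moreover have "\<not> C * (M + 1) ^ k \<le> n"
    using Greatest_le_nat[of "\<lambda>M. C * M ^ k \<le> n" "M + 1" n] bnd unfolding M_def by fastforce
  ultimately show ?thesis by auto
qed

text \<open>Turns the upper estimate for an integer root into one for a real power;
  \<open>1 \<le> C\<close> and \<open>j \<le> k\<close> allow \<open>C powr (j / k)\<close> to be
  relaxed to \<open>C\<close>.\<close>

lemma powr_divide_le:
  fixes x y C :: real and j k :: nat
  assumes "0 \<le> x" "0 < y" "1 \<le> C" "x \<le> C * y ^ k" "j \<le> k" "0 < k"
  shows "x powr (real j / real k) \<le> C * y ^ j"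
proof -
  have "x powr (real j / real k) \<le> (C * y ^ k) powr (real j / real k)"
    using assms by (intro powr_mono2) auto
  also have "\<dots> = C powr (real j / real k) * (y ^ k) powr (real j / real k)"
    using assms by (simp add: powr_mult)
  also have "(y ^ k) powr (real j / real k) = y ^ j"
    using assms by (simp add: powr_powr flip: powr_realpow)
  also have "C powr (real j / real k) \<le> C powr 1"
    using assms by (intro powr_mono) auto
  finally show ?thesis using assms by (simp add: mult_right_mono)
qed

text \<open>In use, \<open>M\<close> is of order \<open>n powr (1 / (d + 1))\<close> and
  \<open>Q\<close> of order \<open>p powr (1 / d)\<close>. Solving \<open>l * a = M\<close> and
  \<open>l * a\<^sup>2 = Q\<close> gives \<open>a = Q / M\<close> and \<open>l = M / a\<close>, with
  \<open>l * Q ^ (m + 1) = M\<^sup>2 * Q ^ m\<close> edges. The other two cases are those where a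
  rounded parameter is \<open>0\<close>.\<close>

lemma ex_preserver_bound:
  assumes n: "2 \<le> n" and p: "p \<le> n\<^sup>2" "1 \<le> p" and MQ: "1 \<le> M" "1 \<le> Q"
    and M: "2 ^ (m + 1) * (m + 1) * M ^ (m + 2) \<le> n" and Q: "Q ^ (m + 1) \<le> p"
  shows "\<exists>k. preserver_bound n p k \<and> M\<^sup>2 * Q ^ m \<le> 9 * 4 ^ (m + 1) * k"
proof -
  define a l where "a = Q div M" and "l = M div a"
  have one: "1 \<le> (4::nat) ^ (m + 1)" "1 \<le> (2::nat) ^ (m + 1) * (m + 1)"
    by (simp_all only: Suc_le_eq One_nat_def) simp_all
  consider (path) "Q < M" | (bipartite) "M < a" | (grid) "1 \<le> a" "1 \<le> l"
    using MQ unfolding a_def l_def by (force simp: Suc_le_eq div_greater_zero_iff)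
  then show ?thesis
  proof cases
    case path
    \<comment> \<open>For \<open>Q < M\<close> the target is at most
      \<open>M ^ (m + 2) \<le> n\<close>, and \<open>n \<le> 2 * (n - 1)\<close>, so a path
      suffices.\<close>
    have "M\<^sup>2 * Q ^ m \<le> M\<^sup>2 * M ^ m" using path by (intro mult_left_mono power_mono) auto
    also have "\<dots> = 1 * M ^ (m + 2)" by (simp add: power_add power2_eq_square ac_simps)
    also have "\<dots> \<le> 2 ^ (m + 1) * (m + 1) * M ^ (m + 2)" using one(2) by (rule mult_right_mono) simp
    also have "\<dots> \<le> 9 * 1 * (n - 1)" using M n by simp
    also have "\<dots> \<le> 9 * 4 ^ (m + 1) * (n - 1)"
      using one(1) by (intro mult_right_mono mult_left_mono) auto
    finally show ?thesis using preserver_bound_path[of n p] n p by auto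
  next
    case bipartite
    \<comment> \<open>Each side gets half of the nodes. From \<open>n \<le> 3 * h\<close> follows
      \<open>p \<le> n\<^sup>2 \<le> 9 * h\<^sup>2\<close>, the source of the factor
      \<open>9\<close>.\<close>
    define h where "h = n div 2"
    define k where "k = min p (h\<^sup>2)"
    have "M\<^sup>2 \<le> M * a" using bipartite by (simp add: power2_eq_square)
    also have "\<dots> \<le> Q" by (simp add: a_def)
    finally have "M\<^sup>2 * Q ^ m \<le> Q ^ (m + 1)" by simp
    also have "\<dots> \<le> p" by (rule Q)
    also have "n \<le> 3 * h" using n by (simp add: h_def)
    then have "n\<^sup>2 \<le> (3 * h)\<^sup>2" by (rule power_mono) simp
    then have "p \<le> 9 * 1 * k" using p by (simp add: k_def power_mult_distrib)
    also have "\<dots> \<le> 9 * 4 ^ (m + 1) * k"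
      using one(1) by (intro mult_right_mono mult_left_mono) auto
    finally have "M\<^sup>2 * Q ^ m \<le> 9 * 4 ^ (m + 1) * k" .
    moreover have "preserver_bound n p k"
      using p by (intro preserver_bound_bipartite[of k h]) (auto simp: k_def h_def)
    ultimately show ?thesis by blast
  next
    case grid
    have la: "l * a \<le> M" and aM: "a * M \<le> Q" by (simp_all add: a_def l_def)
    have "l * a\<^sup>2 = (l * a) * a" by (simp add: power2_eq_square)
    also have "\<dots> \<le> M * a" using la by (rule mult_right_mono) simp
    also have "\<dots> \<le> Q" using aM by (simp add: mult.commute)
    finally have laa: "l * a\<^sup>2 \<le> Q" .
    \<comment> \<open>As \<open>a\<close> and \<open>l\<close> are positive, each rounding loses a
      factor of at most \<open>2\<close>; together the losses are
      \<open>2 ^ m * 2 ^ (m + 2) = 4 ^ (m + 1)\<close>.\<close>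
    have "Q < (a + 1) * M"
      using dividend_less_div_times[of M Q] MQ by (simp add: a_def)
    also have "\<dots> \<le> (2 * a) * M" using grid by (intro mult_right_mono) auto
    finally have Q2: "Q \<le> 2 * a * M" by simp
    have "M < (l + 1) * a"
      using dividend_less_div_times[of a M] grid by (simp add: l_def)
    also have "\<dots> \<le> (2 * l) * a" using grid by (intro mult_right_mono) auto
    finally have M2: "M \<le> 2 * l * a" by simp
    have "M\<^sup>2 * Q ^ m \<le> M\<^sup>2 * (2 * a * M) ^ m"
      using Q2 by (intro mult_left_mono power_mono) auto
    also have "\<dots> = (2 * a) ^ m * M ^ (m + 2)"
      by (simp add: power_mult_distrib power2_eq_square algebra_simps)
    also have "\<dots> \<le> (2 * a) ^ m * (2 * l * a) ^ (m + 2)"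
      using M2 by (intro mult_left_mono power_mono) auto
    also have "\<dots> = (2 ^ m * 2 ^ m * 4) * (l * (l * a\<^sup>2) ^ (m + 1))"
      by (simp add: power_mult_distrib power2_eq_square algebra_simps)
    also have "2 ^ m * 2 ^ m * 4 = (4::nat) ^ (m + 1)"
      by (simp flip: power_mult_distrib)
    finally have "M\<^sup>2 * Q ^ m \<le> 9 * 4 ^ (m + 1) * (l * (l * a\<^sup>2) ^ (m + 1))" by simp
    moreover have "preserver_bound n p (l * (l * a\<^sup>2) ^ (m + 1))"
    proof (rule preserver_bound_grid[OF grid(2) _ _ p(1)])
      have "2 ^ (m + 1) * (m + 1) * (l * a) ^ (m + 2) \<le> 2 ^ (m + 1) * (m + 1) * M ^ (m + 2)"
        using la by (intro mult_left_mono power_mono) auto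
      then show "2 ^ (m + 1) * (m + 1) * (l * a) ^ (m + 2) \<le> n" using M by (rule le_trans)
      show "(l * a\<^sup>2) ^ (m + 1) \<le> p" using power_mono[OF laa, of "m + 1"] Q by simp
    qed
    ultimately show ?thesis by blast
  qed
qed

section \<open>The bound for all sizes, with a constant depending on \<open>d\<close> only\<close>

theorem theorem11:
  fixes d :: nat
  assumes "d \<ge> 2"
  shows "\<exists>c::real. c > 0 \<and>
    (\<forall>n p :: nat. 2 \<le> n \<and> 1 \<le> p \<and> p \<le> n^2 \<longrightarrow>
      (\<exists>(G :: nat pair_pre_digraph) P.
        pair_fin_digraph G \<and> card (pverts G) = n \<and>
        P \<subseteq> pverts G \<times> pverts G \<and> card P = p \<and>
        (\<forall>H. reachability_preserver G P H \<longrightarrow>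
          real (card (parcs H)) \<ge>
            c * real n powr (2 / (real d + 1)) * real (card P) powr ((real d - 1) / real d))))"
proof -
  define m where "m = d - 1"
  have d: "d = m + 1" using assms by (simp add: m_def)
  \<comment> \<open>\<open>\<kappa>\<close> is the node overhead of the grid. In \<open>K\<close>,
    \<open>9 * 4 ^ (m + 1)\<close> comes from \<open>ex_preserver_bound\<close>,
    \<open>2 ^ (m + 2)\<close> from replacing \<open>M + 1\<close> and \<open>Q + 1\<close> by
    \<open>2 * M\<close> and \<open>2 * Q\<close>, and one \<open>\<kappa>\<close> from the root of
    \<open>n\<close>; its square also covers \<open>n < \<kappa>\<close>.\<close>
  define \<kappa> :: nat where "\<kappa> = 2 ^ (m + 1) * (m + 1)"
  define K :: nat where "K = 9 * 4 ^ (m + 1) * 2 ^ (m + 2) * \<kappa>\<^sup>2"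
  have \<kappa>: "1 \<le> \<kappa>" unfolding \<kappa>_def by (simp only: Suc_le_eq One_nat_def) simp
  then have K: "0 < K" by (simp add: K_def)
  have main: "\<exists>k. preserver_bound n p k \<and>
      real n powr (2 / (real d + 1)) * real p powr ((real d - 1) / real d) \<le> real K * real k"
    if n: "2 \<le> n" and p: "1 \<le> p" "p \<le> n\<^sup>2" for n p :: nat
  proof (cases "n < \<kappa>")
    case True
    \<comment> \<open>Too few nodes for \<open>M \<ge> 1\<close>. Both exponents are at most
      \<open>1\<close>, so the target is at most \<open>n * p\<close>, and
      \<open>p \<le> n\<^sup>2 \<le> \<kappa>\<^sup>2\<close> lets the path suffice.\<close>
    have np: "n * p \<le> K * (n - 1)"
    proof -
      have "n * p \<le> (2 * (n - 1)) * \<kappa>\<^sup>2"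
      proof (rule mult_mono)
        have "n\<^sup>2 \<le> \<kappa>\<^sup>2" using True by (intro power_mono) auto
        with p show "p \<le> \<kappa>\<^sup>2" by (auto intro: le_trans)
      qed (use n in auto)
      also have "\<dots> = 2 * 1 * 1 * \<kappa>\<^sup>2 * (n - 1)" by simp
      also have "\<dots> \<le> 9 * 4 ^ (m + 1) * 2 ^ (m + 2) * \<kappa>\<^sup>2 * (n - 1)"
        by (intro mult_mono) auto
      finally show ?thesis by (simp add: K_def)
    qed
    have "real n powr (2 / (real d + 1)) \<le> real n powr 1"
      using n assms by (intro powr_mono) auto
    moreover have "real p powr ((real d - 1) / real d) \<le> real p powr 1"
      using p assms by (intro powr_mono) auto
    ultimately have "real n powr (2 / (real d + 1)) * real p powr ((real d - 1) / real d)
        \<le> real n * real p"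
      by (intro mult_mono) auto
    also have "real n * real p \<le> real K * real (n - 1)"
      using np by (metis of_nat_mult of_nat_le_iff)
    finally show ?thesis using preserver_bound_path[of n p] n p by auto
  next
    case False
    obtain M where M: "\<kappa> * M ^ (m + 2) \<le> n" "n < \<kappa> * (M + 1) ^ (m + 2)"
      using ex_nat_root[of \<kappa> "m + 2" n] \<kappa> by auto
    obtain Q where Q: "1 * Q ^ (m + 1) \<le> p" "p < 1 * (Q + 1) ^ (m + 1)"
      using ex_nat_root[of 1 "m + 1" p] by auto
    \<comment> \<open>\<open>M = 0\<close> would give \<open>n < \<kappa>\<close>, and
      \<open>Q = 0\<close> would give \<open>p < 1\<close>.\<close>
    have MQ: "1 \<le> M" "1 \<le> Q"
      using False M(2) Q(2) p(1) by (cases "M = 0"; cases "Q = 0"; simp)+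
    have "n \<le> \<kappa> * (M + 1) ^ (m + 2)" using M(2) by simp
    also have "\<dots> \<le> \<kappa> * (2 * M) ^ (m + 2)"
      using MQ(1) by (intro mult_left_mono power_mono) auto
    finally have "n \<le> \<kappa> * (2 * M) ^ (m + 2)" .
    then have "real n \<le> real (\<kappa> * (2 * M) ^ (m + 2))" by (rule of_nat_mono)
    then have "real n powr (real 2 / real (m + 2)) \<le> real \<kappa> * real (2 * M) ^ 2"
      using \<kappa> MQ by (intro powr_divide_le) auto
    then have n_powr: "real n powr (2 / (real d + 1)) \<le> real \<kappa> * real (2 * M) ^ 2"
      by (simp add: d add.commute)
    have "p \<le> (2 * Q) ^ (m + 1)"
      using Q(2) MQ(2) power_mono[of "Q + 1" "2 * Q" "m + 1"] by simp
    then have "real p \<le> real ((2 * Q) ^ (m + 1))" by (rule of_nat_mono)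
    then have "real p powr (real m / real (m + 1)) \<le> 1 * real (2 * Q) ^ m"
      using MQ by (intro powr_divide_le) auto
    then have p_powr: "real p powr ((real d - 1) / real d) \<le> real (2 * Q) ^ m"
      by (simp add: d)
    obtain k where k: "preserver_bound n p k" "M\<^sup>2 * Q ^ m \<le> 9 * 4 ^ (m + 1) * k"
      using ex_preserver_bound[OF n p(2,1) MQ] M(1) Q(1) unfolding \<kappa>_def by auto
    have Kk: "2 ^ (m + 2) * \<kappa> * (M\<^sup>2 * Q ^ m) \<le> 2 ^ (m + 2) * \<kappa>\<^sup>2 * (9 * 4 ^ (m + 1) * k)"
    proof (rule mult_mono[OF _ k(2)])
      show "2 ^ (m + 2) * \<kappa> \<le> 2 ^ (m + 2) * \<kappa>\<^sup>2"
        using \<kappa> by (simp add: power2_eq_square)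
    qed simp_all
    have "real n powr (2 / (real d + 1)) * real p powr ((real d - 1) / real d)
        \<le> real \<kappa> * real (2 * M) ^ 2 * real (2 * Q) ^ m"
      using n_powr p_powr by (intro mult_mono) auto
    also have "\<dots> = real (2 ^ (m + 2) * \<kappa> * (M\<^sup>2 * Q ^ m))"
      by (simp add: power_mult_distrib power2_eq_square)
    also have "real (2 ^ (m + 2) * \<kappa> * (M\<^sup>2 * Q ^ m)) \<le> real (K * k)"
      using Kk unfolding K_def by (intro of_nat_mono) (simp add: ac_simps)
    finally show ?thesis using k(1) by auto
  qed
  show ?thesis
  proof (intro exI[of _ "1 / real K"] conjI allI impI)
    fix n p :: nat
    assume "2 \<le> n \<and> 1 \<le> p \<and> p \<le> n\<^sup>2"
    then obtain k where k: "preserver_bound n p k"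
      "real n powr (2 / (real d + 1)) * real p powr ((real d - 1) / real d) \<le> real K * real k"
      using main by blast
    obtain G :: "nat pair_pre_digraph" and P where G: "pair_fin_digraph G" "card (pverts G) = n"
      "P \<subseteq> pverts G \<times> pverts G" "card P = p"
      "\<And>H. reachability_preserver G P H \<Longrightarrow> k \<le> card (parcs H)"
      using k(1) unfolding preserver_bound_def by blast
    have "1 / real K * real n powr (2 / (real d + 1)) * real p powr ((real d - 1) / real d) \<le> real k"
      using k(2) K by (simp add: field_simps)
    then show "\<exists>(G :: nat pair_pre_digraph) P.
        pair_fin_digraph G \<and> card (pverts G) = n \<and>
        P \<subseteq> pverts G \<times> pverts G \<and> card P = p \<and>
        (\<forall>H. reachability_preserver G P H \<longrightarrow>
          real (card (parcs H)) \<ge>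
            1 / real K * real n powr (2 / (real d + 1)) * real (card P) powr ((real d - 1) / real d))"
      using G by (intro exI[of _ G] exI[of _ P]) (force intro: order_trans)
  qed (use K in simp)
qed

end
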